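(* The sequence of Gr\"unwald--Durrmeyer operators $\{\mathcal{D}_n:L^1[0,\pi]\to L^1[0,\pi]\}_{n\in\mathbb{N}}$ is uniformly bounded: there is a constant $\tilde C>0$ such that $\|\mathcal{D}_n(f)\|_1\le\tilde C\|f\|_1$ for all $n\in\{1,2,\dots\}$ and all $f\in L^1[0,\pi]$.
   Context: For $n=1,2,\dots$ and $k=1,\dots,n$ let $\theta_k^{(n)}=\frac{2k-1}{2n}\pi$ and \[ P_k(t)=(-1)^{k+1}\frac{\cos(nt)\,\sin\theta_k^{(n)}}{n\,(\cos t-\cos\theta_k^{(n)})},\qquad t\in\mathbb{R}, \] where the (removable) singularities are filled in by continuity ($P_k$ depends on $n$ as well). Put \[ S_{k,n}(t)=\tfrac12\left(P_k\!\left(t-\tfrac{\pi}{2n}\right)+P_k\!\left(t+\tfrac{\pi}{2n}\right)\right). \] The $n$-th Gr\"unwald--Durrmeyer operator is defined, for $f\in L^p[0,\pi]$ ($1\le p\le+\infty$, Lebesgue measure) and $\theta\in[0,\pi]$, by \[ \mathcal{D}_n(f)(\theta)=\frac{n}{\pi}\sum_{k=1}^n S_{k,n}(\theta)\int_0^\pi f(t)\,S_{k,n}(t)\,dt . \] $\|\cdot\|_1$ is the usual norm of $L^1[0,\pi]$. *)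

theory Defs
  imports "HOL-Analysis.Analysis"
begin

definition grunwald_node :: "nat \<Rightarrow> nat \<Rightarrow> real" where
  "grunwald_node n k = (2 * real k - 1) / (2 * real n) * pi"

definition grunwald_quotient :: "nat \<Rightarrow> nat \<Rightarrow> real \<Rightarrow> real" where
  "grunwald_quotient n k t =
     (-1) ^ (k + 1) * (cos (real n * t) * sin (grunwald_node n k)) / (real n * (cos t - cos (grunwald_node n k)))"

text \<open>The removable singularities are the zeros of the denominator; there the value is the
  limit of the quotient over the punctured neighbourhoods.\<close>

definition grunwald_P :: "nat \<Rightarrow> nat \<Rightarrow> real \<Rightarrow> real" where
  "grunwald_P n k t =
     (if cos t = cos (grunwald_node n k) then Lim (at t) (grunwald_quotient n k) else grunwald_quotient n k t)"

definition grunwald_S :: "nat \<Rightarrow> nat \<Rightarrow> real \<Rightarrow> real" where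
  "grunwald_S n k t = (grunwald_P n k (t - pi / (2 * real n)) + grunwald_P n k (t + pi / (2 * real n))) / 2"

definition grunwald_durrmeyer :: "nat \<Rightarrow> (real \<Rightarrow> real) \<Rightarrow> real \<Rightarrow> real" where
  "grunwald_durrmeyer n f \<theta> =
     real n / pi *
       (\<Sum>k=1..n. grunwald_S n k \<theta> * (LINT t|lebesgue_on {0..pi}. f t * grunwald_S n k t))"

text \<open>Elements of \<open>L\<^sup>1[0,\<pi>]\<close> are represented by functions integrable over \<open>[0,\<pi>]\<close>; their
  values outside this interval are irrelevant. The Bochner integral of a non-integrable function
  is 0, so \<open>L1_norm\<close> is meaningful only together with membership in \<open>L1\<close>.\<close>

definition L1 :: "(real \<Rightarrow> real) set" where
  "L1 = {f. integrable (lebesgue_on {0..pi}) f}"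

definition L1_norm :: "(real \<Rightarrow> real) \<Rightarrow> real" where
  "L1_norm f = (LINT t|lebesgue_on {0..pi}. \<bar>f t\<bar>)"

end

theory Submission imports Defs begin

text \<open>
  The operator has the kernel \<open>n/\<pi> \<Sum>\<^sub>k S\<^sub>k(\<theta>) S\<^sub>k(t)\<close>, so it suffices to bound
  \<open>\<Sum>\<^sub>k |S\<^sub>k(t)|\<close> and \<open>n \<parallel>S\<^sub>k\<parallel>\<^sub>1\<close> independently of \<open>n\<close>, \<open>k\<close> and almost every \<open>t\<close>.
  Put \<open>a = \<pi>/(2n)\<close>. Decomposing \<open>sin \<theta>\<^sub>k / (cos u - cos \<theta>\<^sub>k)\<close> into two cotangents turns \<open>S\<^sub>k(t)\<close>, up to
  sign, into \<open>R(\<theta>\<^sub>k - t) + R(\<theta>\<^sub>k + t)\<close> with the Rogosinski-type kernel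
  \<open>R(x) = sin a / (2n) E(x + a) E(x - a)\<close>, where \<open>E(x) = sin(nx/2) / sin(x/2)\<close>. By AM-GM, \<open>|R|\<close> is at most
  \<open>\<pi>/(8n\<^sup>2)\<close> times the sum of the two Fejer kernels \<open>E(x \<plusminus> a)\<^sup>2\<close>. Since \<open>\<theta>\<^sub>k \<plusminus> a\<close> are multiples of \<open>\<pi>/n\<close>
  and \<open>E\<^sup>2\<close> is a trigonometric polynomial of degree less than \<open>n\<close>, its sum over the \<open>2n\<close> equidistant points
  and its integral over a period are known exactly: \<open>2n\<^sup>2\<close> and \<open>2\<pi>n\<close>. This gives the constant \<open>\<pi>\<^sup>2\<close>.
\<close>

section \<open>The Fejer kernel and its closed form\<close>

definition fejer :: "nat \<Rightarrow> real \<Rightarrow> real" where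
  "fejer n x = (cmod (\<Sum>j<n. cis (real j * x)))\<^sup>2"

lemma fejer_nonneg: "0 \<le> fejer n x"
  by (simp add: fejer_def)

lemma continuous_on_fejer [continuous_intros]:
  "continuous_on A g \<Longrightarrow> continuous_on A (\<lambda>x. fejer n (g x))"
  unfolding fejer_def cis_conv_exp by (intro continuous_intros)

lemma fejer_eq_sum_cos: "fejer n x = (\<Sum>j<n. \<Sum>l<n. cos ((real j - real l) * x))"
proof -
  have "fejer n x = (\<Sum>j<n. cos (real j * x))\<^sup>2 + (\<Sum>j<n. sin (real j * x))\<^sup>2"
    by (simp add: fejer_def cmod_power2)
  also have "\<dots> = (\<Sum>j<n. \<Sum>l<n. cos (real j * x) * cos (real l * x) + sin (real j * x) * sin (real l * x))"
    by (simp add: power2_eq_square sum_product sum.distrib)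
  finally show ?thesis
    by (simp add: cos_diff left_diff_distrib)
qed

lemma cmod_one_minus_cis: "(cmod (1 - cis x))\<^sup>2 = 4 * (sin (x / 2))\<^sup>2"
proof -
  have "(cmod (1 - cis x))\<^sup>2 = (1 - cos x)\<^sup>2 + (sin x)\<^sup>2"
    by (simp add: cmod_power2)
  also have "\<dots> = 2 - 2 * cos (2 * (x / 2))"
    using sin_cos_squared_add[of x] by (simp add: power2_eq_square algebra_simps)
  finally show ?thesis
    by (simp only: cos_double_sin) simp
qed

text \<open>A geometric sum in \<open>cis x\<close>. The product form also covers the zeros of
  \<open>sin (x / 2)\<close>, where the quotient has a removable singularity.\<close>

lemma fejer_times_sin: "fejer n x * (sin (x / 2))\<^sup>2 = (sin (real n * x / 2))\<^sup>2"
proof -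
  have "(1 - cis x) * (\<Sum>j<n. cis (real j * x)) = 1 - cis (real n * x)"
    using one_diff_power_eq[of "cis x" n] by (simp flip: Complex.DeMoivre)
  hence "(cmod (1 - cis x))\<^sup>2 * fejer n x = (cmod (1 - cis (real n * x)))\<^sup>2"
    by (metis fejer_def norm_mult power_mult_distrib)
  thus ?thesis
    by (simp add: cmod_one_minus_cis mult.commute)
qed

lemma fejer_double:
  assumes "sin x \<noteq> 0"
  shows "fejer n (2 * x) = (sin (real n * x) / sin x)\<^sup>2"
  using fejer_times_sin[of n "2 * x"] assms by (simp add: field_simps)

section \<open>Exact sums over equidistant points and integrals over a period\<close>

lemma sum_cos_equispaced:
  fixes q :: int
  assumes "q \<noteq> 0" and "\<bar>q\<bar> < int N"
  shows "(\<Sum>m<N. cos (of_int q * (s + real m * (2 * pi / N)))) = 0"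
proof -
  \<comment> \<open>Up to a constant factor the complex sum is geometric with ratio
    \<open>z\<close>, an \<open>N\<close>-th root of unity that is not 1 because \<open>N\<close>
    does not divide \<open>q\<close>.\<close>
  define z where "z = cis (of_int q * (2 * pi / N))"
  have N: "N > 0" using assms by auto
  have "z \<noteq> 1"
  proof
    assume "z = 1"
    hence "cos (of_int q * (2 * pi / N)) = 1"
      by (simp add: z_def complex_eq_iff)
    then obtain k :: int where "of_int q * (2 * pi / N) = of_int k * 2 * pi"
      using cos_one_2pi_int by blast
    hence "real_of_int q = real_of_int (k * int N)"
      using N by (simp add: field_simps)
    hence "q = k * int N" by linarith
    with assms show False
      using dvd_imp_le_int[of q "int N"] by auto
  qed
  moreover have "z ^ N = cis (2 * pi * of_int q)"
    using N by (simp add: z_def Complex.DeMoivre mult.commute)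
  hence "z ^ N = 1" by simp
  ultimately have "(\<Sum>m<N. z ^ m) = 0"
    by (simp add: geometric_sum)
  hence "(\<Sum>m<N. cis (of_int q * s) * z ^ m) = 0"
    by (simp flip: sum_distrib_left)
  also have "(\<lambda>m. cis (of_int q * s) * z ^ m) = (\<lambda>m. cis (of_int q * (s + real m * (2 * pi / N))))"
    by (simp add: z_def Complex.DeMoivre cis_mult algebra_simps)
  finally show ?thesis
    by (simp add: complex_eq_iff)
qed

text \<open>The frequencies \<open>j - l\<close> are smaller than \<open>2 * n\<close> in modulus,
  so only the \<open>n\<close> diagonal terms survive, each contributing
  \<open>2 * n\<close>.\<close>

lemma sum_fejer_equispaced:
  assumes "n \<ge> 1"
  shows "(\<Sum>m<2 * n. fejer n (s + real m * (pi / n))) = 2 * (real n)\<^sup>2"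
proof -
  have "(\<Sum>m<2 * n. cos ((real j - real l) * (s + real m * (pi / n)))) = (if j = l then 2 * real n else 0)"
    if "j < n" "l < n" for j l
    using sum_cos_equispaced[of "int j - int l" "2 * n" s] that by auto
  hence "(\<Sum>j<n. \<Sum>l<n. \<Sum>m<2 * n. cos ((real j - real l) * (s + real m * (pi / n)))) = 2 * (real n)\<^sup>2"
    by (simp add: power2_eq_square)
  also have "(\<Sum>j<n. \<Sum>l<n. \<Sum>m<2 * n. cos ((real j - real l) * (s + real m * (pi / n)))) =
      (\<Sum>j<n. \<Sum>m<2 * n. \<Sum>l<n. cos ((real j - real l) * (s + real m * (pi / n))))"
    by (rule sum.cong[OF refl], rule sum.swap)
  also have "\<dots> = (\<Sum>m<2 * n. fejer n (s + real m * (pi / n)))"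
    unfolding fejer_eq_sum_cos by (rule sum.swap)
  finally show ?thesis .
qed

lemma has_integral_cos_period:
  fixes q :: int
  assumes "q \<noteq> 0"
  shows "((\<lambda>t. cos (c + of_int q * t)) has_integral 0) {0..2 * pi}"
proof -
  have "((\<lambda>t. cos (c + of_int q * t)) has_integral
      (sin (c + of_int q * (2 * pi)) / of_int q - sin (c + of_int q * 0) / of_int q)) {0..2 * pi}"
    using assms
    by (intro fundamental_theorem_of_calculus)
       (auto intro!: derivative_eq_intros simp flip: has_real_derivative_iff_has_vector_derivative)
  moreover have "sin (c + of_int q * (2 * pi)) = sin c"
    using sin_add[of c "2 * pi * of_int q"] by (simp add: mult.commute[of _ "2 * pi"])
  ultimately show ?thesis by simp
qed

text \<open>Orthogonality again leaves only the diagonal. The sign \<open>e\<close> serves both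
  \<open>s + t\<close> and \<open>s - t\<close>, which occur in the majorant.\<close>

lemma has_integral_fejer_period:
  fixes e :: int
  assumes "\<bar>e\<bar> = 1"
  shows "((\<lambda>t. fejer n (s + of_int e * t)) has_integral 2 * pi * n) {0..2 * pi}"
proof -
  have *: "((\<lambda>t. cos ((real j - real l) * (s + of_int e * t))) has_integral (if j = l then 2 * pi else 0)) {0..2 * pi}"
    for j l
  proof (cases "j = l")
    case True
    then show ?thesis
      using has_integral_const_real[of "1 :: real" 0 "2 * pi"] by simp
  next
    case False
    hence "(int j - int l) * e \<noteq> 0" using assms by auto
    from has_integral_cos_period[OF this, of "(real j - real l) * s"] False show ?thesis
      by (simp add: algebra_simps)
  qed
  have "((\<lambda>t. \<Sum>j<n. \<Sum>l<n. cos ((real j - real l) * (s + of_int e * t))) has_integral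
      (\<Sum>j<n. \<Sum>l<n. if j = l then 2 * pi else 0)) {0..2 * pi}"
    by (intro has_integral_sum * finite_lessThan)
  thus ?thesis
    by (simp add: fejer_eq_sum_cos mult.commute)
qed

lemma integrable_fejer: "integrable (lebesgue_on {a..b}) (\<lambda>t. fejer n (s + c * t))"
  by (intro continuous_imp_integrable_real continuous_intros)

text \<open>Nonnegativity allows enlarging the half period to a full one.\<close>

lemma integral_fejer_le:
  fixes e :: int
  assumes "\<bar>e\<bar> = 1"
  shows "(LINT t|lebesgue_on {0..pi}. fejer n (s + of_int e * t)) \<le> 2 * pi * n"
proof -
  have "(LINT t|lebesgue_on {0..pi}. fejer n (s + of_int e * t)) = integral {0..pi} (\<lambda>t. fejer n (s + of_int e * t))"
    by (intro lebesgue_integral_eq_integral integrable_fejer) auto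
  also have "\<dots> \<le> integral {0..2 * pi} (\<lambda>t. fejer n (s + of_int e * t))"
    by (intro integral_subset_le integrable_continuous_real continuous_intros) (auto simp: fejer_nonneg)
  also have "\<dots> = 2 * pi * n"
    using has_integral_fejer_period[OF assms] by (rule integral_unique)
  finally show ?thesis .
qed

section \<open>Pointwise majorant of \<open>S\<^sub>k\<close>\<close>

lemma sin_div_eq_cot:
  fixes A B :: real
  assumes "sin A \<noteq> 0" "sin B \<noteq> 0"
  shows "sin (A + B) / (sin A * sin B) = cot A + cot B"
    and "sin (A - B) / (sin A * sin B) = cot B - cot A"
  using assms by (simp_all add: cot_def sin_add sin_diff field_simps)

text \<open>The numerator is \<open>2 sin(nA) sin(nB)\<close>, so the left side is twice the product
  of two quotients whose squares are the Fejer kernels.\<close>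

lemma fejer_amgm:
  assumes "sin A \<noteq> 0" "sin B \<noteq> 0"
  shows "\<bar>cos (real n * (A - B)) - cos (real n * (A + B))\<bar> / \<bar>sin A * sin B\<bar> \<le> fejer n (2 * A) + fejer n (2 * B)"
proof -
  define p q where "p = \<bar>sin (real n * A) / sin A\<bar>" and "q = \<bar>sin (real n * B) / sin B\<bar>"
  have "cos (real n * (A - B)) - cos (real n * (A + B)) = 2 * (sin (real n * A) * sin (real n * B))"
    by (simp add: cos_add cos_diff algebra_simps)
  hence "\<bar>cos (real n * (A - B)) - cos (real n * (A + B))\<bar> / \<bar>sin A * sin B\<bar> = 2 * (p * q)"
    by (simp add: p_def q_def abs_mult)
  also have "\<dots> \<le> p\<^sup>2 + q\<^sup>2"
    using sum_squares_bound[of p q] by simp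
  also have "\<dots> = fejer n (2 * A) + fejer n (2 * B)"
    using assms by (simp add: fejer_double p_def q_def power_divide)
  finally show ?thesis .
qed

text \<open>The arguments are \<open>\<theta>\<^sub>k - t\<close> and
  \<open>\<theta>\<^sub>k + t\<close>, each shifted by \<open>a\<close> and \<open>- a\<close>,
  written on the grid of step \<open>pi / n\<close> so that the equidistant sum applies.\<close>

definition grunwald_majorant :: "nat \<Rightarrow> nat \<Rightarrow> real \<Rightarrow> real" where
  "grunwald_majorant n k t = pi / (8 * (real n)\<^sup>2) *
    (fejer n (- t + real k * (pi / n)) + fejer n (- t + real (k - 1) * (pi / n)) +
     (fejer n (t + real k * (pi / n)) + fejer n (t + real (k - 1) * (pi / n))))"

lemma abs_grunwald_S_le:
  assumes "n \<ge> 1" "k \<ge> 1"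
    and "cos (t - pi / (2 * real n)) \<noteq> cos (grunwald_node n k)"
    and "cos (t + pi / (2 * real n)) \<noteq> cos (grunwald_node n k)"
  shows "\<bar>grunwald_S n k t\<bar> \<le> grunwald_majorant n k t"
proof -
  define a where "a = pi / (2 * real n)"
  define \<theta> where "\<theta> = grunwald_node n k"
  \<comment> \<open>The denominators factor through the pairs \<open>A, D\<close> and
    \<open>B, C\<close>, which add up to \<open>\<theta>\<close>; the pairs \<open>A, B\<close> and
    \<open>C, D\<close> differ by \<open>a\<close>.\<close>
  define A B C D where "A = (\<theta> - t + a) / 2" and "B = (\<theta> - t - a) / 2"
    and "C = (\<theta> + t + a) / 2" and "D = (\<theta> + t - a) / 2"
  have n: "real n > 0" using assms by simp
  have na: "real n * a = pi / 2" using n by (simp add: a_def)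
  have n\<theta>: "real n * \<theta> = real k * pi - pi / 2"
    using n by (simp add: \<theta>_def grunwald_node_def field_simps)
  have c0: "cos (real n * \<theta>) = 0"
    by (simp add: n\<theta> cos_diff)
  hence s1: "\<bar>sin (real n * \<theta>)\<bar> = 1"
    using sin_cos_squared_add[of "real n * \<theta>"] by (simp add: abs_square_eq_1 power2_eq_1_iff)
  have d1: "cos (t - a) - cos \<theta> = 2 * (sin A * sin D)"
    using cos_diff_cos[of "t - a" \<theta>] by (simp add: A_def D_def algebra_simps)
  have d2: "cos (t + a) - cos \<theta> = 2 * (sin B * sin C)"
    using cos_diff_cos[of "t + a" \<theta>] by (simp add: B_def C_def algebra_simps)
  have nz: "sin A \<noteq> 0" "sin B \<noteq> 0" "sin C \<noteq> 0" "sin D \<noteq> 0"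
    using assms(3,4) d1 d2 by (auto simp flip: a_def \<theta>_def)
  have sums: "A + D = \<theta>" "B + C = \<theta>" "A - B = a" "C - D = a"
    by (simp_all add: A_def B_def C_def D_def field_simps)
  have P: "grunwald_P n k u = (-1) ^ (k + 1) / real n * (cos (real n * u) * (sin \<theta> / (cos u - cos \<theta>)))"
    if "cos u \<noteq> cos \<theta>" for u
    using that by (simp add: grunwald_P_def grunwald_quotient_def flip: \<theta>_def)
  have S: "(c / N * (s * X) + c / N * (- s * Y)) / 2 = c / (2 * N) * s * (X - Y)" for c N s X Y :: real
    by (cases "N = 0") (simp_all add: field_simps)
  \<comment> \<open>The shift \<open>a\<close> is a quarter period of \<open>cos (n u)\<close>. The
    opposite signs turn the average into a difference.\<close>
  have "cos (real n * (t - a)) = sin (real n * t)" "cos (real n * (t + a)) = - sin (real n * t)"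
    by (simp_all add: right_diff_distrib distrib_left na cos_diff cos_add)
  hence "grunwald_S n k t = (-1) ^ (k + 1) / (2 * real n) * sin (real n * t) *
      (sin \<theta> / (cos (t - a) - cos \<theta>) - sin \<theta> / (cos (t + a) - cos \<theta>))"
    using assms(3,4) unfolding grunwald_S_def a_def[symmetric] \<theta>_def[symmetric]
    by (simp only: P S not_False_eq_True)
  also have "sin \<theta> / (cos (t - a) - cos \<theta>) = (cot A + cot D) / 2"
    using sin_div_eq_cot(1)[of A D] nz sums d1 by (simp add: field_simps)
  also have "sin \<theta> / (cos (t + a) - cos \<theta>) = (cot B + cot C) / 2"
    using sin_div_eq_cot(1)[of B C] nz sums d2 by (simp add: field_simps)
  \<comment> \<open>Regrouping into pairs that differ by \<open>a\<close> produces the factor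
    \<open>sin a\<close>, which gains the extra power of \<open>1 / n\<close>.\<close>
  also have "(cot A + cot D) / 2 - (cot B + cot C) / 2 = ((cot D - cot C) - (cot B - cot A)) / 2"
    by (simp add: field_simps)
  also have "cot D - cot C = sin a / (sin C * sin D)"
    using sin_div_eq_cot(2)[of C D] nz sums by simp
  also have "cot B - cot A = sin a / (sin A * sin B)"
    using sin_div_eq_cot(2)[of A B] nz sums by simp
  finally have "\<bar>grunwald_S n k t\<bar> = \<bar>sin (real n * t)\<bar> / (4 * real n) *
      \<bar>sin a / (sin C * sin D) - sin a / (sin A * sin B)\<bar>"
    by (simp add: abs_mult power_abs)
  also have "\<dots> \<le> \<bar>sin (real n * t)\<bar> / (4 * real n) *
      (a / \<bar>sin C * sin D\<bar> + a / \<bar>sin A * sin B\<bar>)"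
  proof -
    have "\<bar>sin a\<bar> \<le> a"
      using abs_sin_x_le_abs_x[of a] n by (simp add: a_def)
    hence "\<bar>sin a / z\<bar> \<le> a / \<bar>z\<bar>" for z :: real
      by (simp add: divide_right_mono)
    thus ?thesis
      by (intro mult_left_mono order.trans[OF abs_triangle_ineq4] add_mono) auto
  qed
  also have "\<dots> = pi / (8 * (real n)\<^sup>2) * (\<bar>sin (real n * t)\<bar> / \<bar>sin A * sin B\<bar> + \<bar>sin (real n * t)\<bar> / \<bar>sin C * sin D\<bar>)"
    by (simp add: a_def power2_eq_square add_divide_distrib distrib_left mult_ac)
  also have "\<dots> \<le> pi / (8 * (real n)\<^sup>2) * ((fejer n (2 * A) + fejer n (2 * B)) + (fejer n (2 * C) + fejer n (2 * D)))"
  proof (intro mult_left_mono add_mono)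
    \<comment> \<open>Since \<open>cos (n a) = 0\<close>, one cosine in the numerator of
      \<open>fejer_amgm\<close> vanishes and the other has modulus
      \<open>\<bar>sin (n t)\<bar>\<close>.\<close>
    have "\<bar>cos (real n * (\<theta> - t))\<bar> = \<bar>sin (real n * t)\<bar>" "\<bar>cos (real n * (\<theta> + t))\<bar> = \<bar>sin (real n * t)\<bar>"
      by (simp_all add: right_diff_distrib distrib_left cos_diff cos_add c0 s1 abs_mult)
    moreover have "A + B = \<theta> - t" "C + D = \<theta> + t"
      by (simp_all add: A_def B_def C_def D_def field_simps)
    ultimately show "\<bar>sin (real n * t)\<bar> / \<bar>sin A * sin B\<bar> \<le> fejer n (2 * A) + fejer n (2 * B)"
      and "\<bar>sin (real n * t)\<bar> / \<bar>sin C * sin D\<bar> \<le> fejer n (2 * C) + fejer n (2 * D)"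
      using fejer_amgm[OF nz(1,2), of n] fejer_amgm[OF nz(3,4), of n] by (simp_all add: sums(3,4) na)
  qed simp
  finally have "\<bar>grunwald_S n k t\<bar> \<le> pi / (8 * (real n)\<^sup>2) *
      (fejer n (2 * A) + fejer n (2 * B) + (fejer n (2 * C) + fejer n (2 * D)))" .
  moreover have "2 * A = - t + real k * (pi / n)" "2 * B = - t + real (k - 1) * (pi / n)"
    "2 * C = t + real k * (pi / n)" "2 * D = t + real (k - 1) * (pi / n)"
    using n \<open>k \<ge> 1\<close> by (simp_all add: A_def B_def C_def D_def a_def \<theta>_def grunwald_node_def of_nat_diff field_simps)
  ultimately show ?thesis
    by (simp only: grunwald_majorant_def)
qed

text \<open>Both sums run over \<open>n\<close> of the \<open>2 * n\<close> equidistant points, and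
  the omitted terms are nonnegative.\<close>

lemma sum_fejer_le:
  assumes "n \<ge> 1"
  shows "(\<Sum>k=1..n. fejer n (s + real k * (pi / n))) \<le> 2 * (real n)\<^sup>2"
    and "(\<Sum>k=1..n. fejer n (s + real (k - 1) * (pi / n))) \<le> 2 * (real n)\<^sup>2"
proof -
  show "(\<Sum>k=1..n. fejer n (s + real k * (pi / n))) \<le> 2 * (real n)\<^sup>2"
    unfolding sum_fejer_equispaced[OF assms, symmetric, of s]
    using assms by (intro sum_mono2) (auto simp: fejer_nonneg)
  have "(\<Sum>k=1..n. fejer n (s + real (k - 1) * (pi / n))) = (\<Sum>m<n. fejer n (s + real m * (pi / n)))"
    by (intro sum.reindex_bij_witness[of _ Suc "\<lambda>k. k - 1"]) auto
  also have "\<dots> \<le> 2 * (real n)\<^sup>2"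
    unfolding sum_fejer_equispaced[OF assms, symmetric, of s]
    using assms by (intro sum_mono2) (auto simp: fejer_nonneg)
  finally show "(\<Sum>k=1..n. fejer n (s + real (k - 1) * (pi / n))) \<le> 2 * (real n)\<^sup>2" .
qed

section \<open>Singularities and measurability\<close>

lemma countable_cos_eq: "countable {t :: real. cos (t + b) = c}"
proof (cases "\<exists>u. cos u = c")
  case True
  then obtain u where u: "cos u = c" by blast
  have "{t. cos (t + b) = c} \<subseteq> (\<Union>n\<in>\<int>. {u + 2 * n * pi - b, - u + 2 * n * pi - b})"
    by (auto simp: cos_eq simp flip: u)
  moreover have "countable (\<int> :: real set)"
    by (simp add: Ints_def)
  ultimately show ?thesis
    by (meson countable_UN countable_finite finite.intros countable_subset)
qed auto

text \<open>The removable singularities of all \<open>S\<^sub>k\<close>. They form a null set, so the values assigned there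
  (the limits in \<^const>\<open>grunwald_P\<close>) never have to be computed.\<close>

definition grunwald_sing :: "nat \<Rightarrow> real set" where
  "grunwald_sing n = (\<Union>k\<in>{1..n}. {t. cos (t - pi / (2 * real n)) = cos (grunwald_node n k)} \<union>
     {t. cos (t + pi / (2 * real n)) = cos (grunwald_node n k)})"

lemma countable_grunwald_sing: "countable (grunwald_sing n)"
  unfolding grunwald_sing_def
  using countable_cos_eq[of "- (pi / (2 * real n))"] countable_cos_eq[of "pi / (2 * real n)"]
  by (intro countable_UN countable_Un) auto

lemma AE_not_grunwald_sing: "AE t in lebesgue_on {0..pi}. t \<notin> grunwald_sing n"
proof -
  have "grunwald_sing n \<in> null_sets lebesgue"
    using countable_grunwald_sing countable_imp_null_set_lborel null_sets_completionI by blast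
  from AE_not_in[OF this] show ?thesis
    by (auto simp: AE_restrict_space_iff elim: eventually_mono)
qed

lemma grunwald_S_measurable:
  assumes "k \<in> {1..n}"
  shows "grunwald_S n k \<in> borel_measurable (lebesgue_on {0..pi})"
proof -
  \<comment> \<open>The bare quotient takes the value 0 where its denominator vanishes. It is Borel
    and differs from \<open>S\<^sub>k\<close> only on a countable set.\<close>
  define g where "g t = (grunwald_quotient n k (t - pi / (2 * real n)) + grunwald_quotient n k (t + pi / (2 * real n))) / 2" for t
  have "g \<in> borel_measurable borel"
    unfolding g_def grunwald_quotient_def by measurable
  hence "grunwald_S n k \<in> borel_measurable borel"
  proof (rule measurable_discrete_difference[OF _ countable_grunwald_sing[of n]])
    fix t assume "t \<notin> grunwald_sing n"
    thus "g t = grunwald_S n k t"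
      using assms by (auto simp: g_def grunwald_S_def grunwald_P_def grunwald_sing_def)
  qed auto
  thus ?thesis
    by (auto intro!: measurable_restrict_space1 measurable_completion)
qed

lemma AE_grunwald_S_le_majorant:
  "AE t in lebesgue_on {0..pi}. \<forall>k\<in>{1..n}. \<bar>grunwald_S n k t\<bar> \<le> grunwald_majorant n k t"
  using AE_not_grunwald_sing[of n]
proof (rule AE_mp, intro AE_I2 impI ballI)
  fix t k assume "t \<notin> grunwald_sing n" "k \<in> {1..n}"
  thus "\<bar>grunwald_S n k t\<bar> \<le> grunwald_majorant n k t"
    by (intro abs_grunwald_S_le) (auto simp: grunwald_sing_def)
qed

section \<open>Bounds for the sum over \<open>k\<close> and for the \<open>L1_norm\<close> of each
  \<open>S\<^sub>k\<close>\<close>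

lemma grunwald_majorant_nonneg: "0 \<le> grunwald_majorant n k t"
  by (simp add: grunwald_majorant_def fejer_nonneg)

text \<open>Four sums of at most \<open>2 n\<^sup>2\<close> cancel the prefactor up to
  \<open>pi\<close>.\<close>

lemma sum_grunwald_majorant_le:
  assumes "n \<ge> 1"
  shows "(\<Sum>k=1..n. grunwald_majorant n k t) \<le> pi"
proof -
  have "(\<Sum>k=1..n. grunwald_majorant n k t) \<le> pi / (8 * (real n)\<^sup>2) *
     (2 * (real n)\<^sup>2 + 2 * (real n)\<^sup>2 + (2 * (real n)\<^sup>2 + 2 * (real n)\<^sup>2))"
    unfolding grunwald_majorant_def sum_distrib_left[symmetric] sum.distrib
    by (intro mult_left_mono add_mono sum_fejer_le assms) auto
  also have "\<dots> = pi" using assms by simp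
  finally show ?thesis .
qed

lemma integrable_grunwald_majorant: "integrable (lebesgue_on {0..pi}) (grunwald_majorant n k)"
  unfolding grunwald_majorant_def by (intro continuous_imp_integrable_real continuous_intros)

text \<open>Four integrals of at most \<open>2 * pi * n\<close>, times the prefactor.\<close>

lemma integral_grunwald_majorant_le:
  assumes "n \<ge> 1"
  shows "(LINT t|lebesgue_on {0..pi}. grunwald_majorant n k t) \<le> pi\<^sup>2 / n"
proof -
  have I: "integrable (lebesgue_on {0..pi}) (\<lambda>t. fejer n (- t + s))"
    "integrable (lebesgue_on {0..pi}) (\<lambda>t. fejer n (t + s))" for s
    by (intro continuous_imp_integrable_real continuous_intros)+
  have L: "(LINT t|lebesgue_on {0..pi}. fejer n (- t + s)) \<le> 2 * pi * n"
    "(LINT t|lebesgue_on {0..pi}. fejer n (t + s)) \<le> 2 * pi * n" for s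
    using integral_fejer_le[of "-1" n s] integral_fejer_le[of 1 n s] by (simp_all add: add.commute)
  have "(LINT t|lebesgue_on {0..pi}. grunwald_majorant n k t) \<le> pi / (8 * (real n)\<^sup>2) *
     (2 * pi * n + 2 * pi * n + (2 * pi * n + 2 * pi * n))"
    unfolding grunwald_majorant_def
    by (simp only: integral_mult_right_zero Bochner_Integration.integral_add Bochner_Integration.integrable_add I)
       (intro mult_left_mono add_mono L; simp)
  also have "\<dots> = pi\<^sup>2 / n"
    using assms by (simp add: power2_eq_square field_simps)
  finally show ?thesis .
qed

lemma integrable_grunwald_S:
  assumes "k \<in> {1..n}"
  shows "integrable (lebesgue_on {0..pi}) (grunwald_S n k)"
  using AE_grunwald_S_le_majorant[of n] assms
  by (intro Bochner_Integration.integrable_bound[OF integrable_grunwald_majorant[of n k]] grunwald_S_measurable)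
     (auto elim!: eventually_mono simp: grunwald_majorant_nonneg)

lemma L1_norm_grunwald_S_le:
  assumes "k \<in> {1..n}"
  shows "L1_norm (grunwald_S n k) \<le> pi\<^sup>2 / n"
proof -
  have "L1_norm (grunwald_S n k) \<le> (LINT t|lebesgue_on {0..pi}. grunwald_majorant n k t)"
    unfolding L1_norm_def using AE_grunwald_S_le_majorant[of n] assms
    by (intro integral_mono_AE integrable_abs integrable_grunwald_S integrable_grunwald_majorant)
       (auto elim!: eventually_mono)
  thus ?thesis
    using integral_grunwald_majorant_le[of n k] assms by simp
qed

lemma AE_sum_abs_grunwald_S_le:
  assumes "n \<ge> 1"
  shows "AE t in lebesgue_on {0..pi}. (\<Sum>k=1..n. \<bar>grunwald_S n k t\<bar>) \<le> pi"
  using AE_grunwald_S_le_majorant[of n]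
proof (rule eventually_mono)
  fix t assume "\<forall>k\<in>{1..n}. \<bar>grunwald_S n k t\<bar> \<le> grunwald_majorant n k t"
  hence "(\<Sum>k=1..n. \<bar>grunwald_S n k t\<bar>) \<le> (\<Sum>k=1..n. grunwald_majorant n k t)"
    by (intro sum_mono) auto
  thus "(\<Sum>k=1..n. \<bar>grunwald_S n k t\<bar>) \<le> pi"
    using sum_grunwald_majorant_le[OF assms, of t] by linarith
qed

section \<open>The operator bound\<close>

lemma integrable_times_grunwald_S:
  assumes f: "integrable (lebesgue_on {0..pi}) f" and k: "k \<in> {1..n}"
  shows "integrable (lebesgue_on {0..pi}) (\<lambda>t. f t * grunwald_S n k t)"
proof (rule Bochner_Integration.integrable_bound)
  show "integrable (lebesgue_on {0..pi}) (\<lambda>t. pi * f t)"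
    using f by simp
  show "(\<lambda>t. f t * grunwald_S n k t) \<in> borel_measurable (lebesgue_on {0..pi})"
    using grunwald_S_measurable[OF k] f by measurable
  have "n \<ge> 1" using k by auto
  from AE_sum_abs_grunwald_S_le[OF this]
  show "AE t in lebesgue_on {0..pi}. norm (f t * grunwald_S n k t) \<le> norm (pi * f t)"
  proof (rule eventually_mono)
    fix t assume *: "(\<Sum>k=1..n. \<bar>grunwald_S n k t\<bar>) \<le> pi"
    have "\<bar>grunwald_S n k t\<bar> \<le> (\<Sum>k=1..n. \<bar>grunwald_S n k t\<bar>)"
      using k by (intro member_le_sum) auto
    with * have "\<bar>f t\<bar> * \<bar>grunwald_S n k t\<bar> \<le> \<bar>f t\<bar> * pi"
      by (intro mult_left_mono) auto
    thus "norm (f t * grunwald_S n k t) \<le> norm (pi * f t)"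
      by (simp add: abs_mult mult.commute)
  qed
qed

theorem lemma4p1:
  "\<exists>C::real. C > 0 \<and>
     (\<forall>n\<ge>1. \<forall>f\<in>L1. grunwald_durrmeyer n f \<in> L1 \<and>
        L1_norm (grunwald_durrmeyer n f) \<le> C * L1_norm f)"
proof (intro exI[of _ "pi\<^sup>2"] conjI allI impI ballI)
  \<comment> \<open>One factor \<open>pi\<close> is \<open>n / pi\<close> times the norm bound
    \<open>pi\<^sup>2 / n\<close>; the other bounds the sum of all
    \<open>\<bar>S\<^sub>k(t)\<bar>\<close>.\<close>
  fix n :: nat and f assume n: "n \<ge> 1" and "f \<in> L1"
  let ?M = "lebesgue_on {0..pi}"
  have f: "integrable ?M f" using \<open>f \<in> L1\<close> by (simp add: L1_def)
  define c where "c k = (LINT t|?M. f t * grunwald_S n k t)" for k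
  have D: "grunwald_durrmeyer n f = (\<lambda>\<theta>. \<Sum>k=1..n. (n / pi * c k) * grunwald_S n k \<theta>)"
    by (simp add: fun_eq_iff grunwald_durrmeyer_def c_def sum_distrib_left mult_ac)
  have I: "integrable ?M (\<lambda>\<theta>. r * grunwald_S n k \<theta>)" "integrable ?M (\<lambda>\<theta>. \<bar>grunwald_S n k \<theta>\<bar>)"
    if "k \<in> {1..n}" for k r
    using integrable_grunwald_S[OF that] by auto
  show DL1: "grunwald_durrmeyer n f \<in> L1"
    unfolding L1_def D by (auto intro!: Bochner_Integration.integrable_sum I)
  have "L1_norm (grunwald_durrmeyer n f) \<le> (LINT \<theta>|?M. (\<Sum>k=1..n. (n / pi * \<bar>c k\<bar>) * \<bar>grunwald_S n k \<theta>\<bar>))"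
    unfolding L1_norm_def
  proof (intro integral_mono)
    show "integrable ?M (\<lambda>t. \<bar>grunwald_durrmeyer n f t\<bar>)"
      using DL1 by (auto simp: L1_def)
    show "\<bar>grunwald_durrmeyer n f \<theta>\<bar> \<le> (\<Sum>k=1..n. (n / pi * \<bar>c k\<bar>) * \<bar>grunwald_S n k \<theta>\<bar>)" for \<theta>
      unfolding D by (rule order.trans[OF sum_abs]) (simp add: abs_mult)
  qed (auto intro!: Bochner_Integration.integrable_sum integrable_mult_right I)
  also have "\<dots> = (\<Sum>k=1..n. (n / pi * \<bar>c k\<bar>) * L1_norm (grunwald_S n k))"
    unfolding L1_norm_def
    by (subst Bochner_Integration.integral_sum) (auto intro!: integrable_mult_right I)
  also have "\<dots> \<le> (\<Sum>k=1..n. (n / pi * \<bar>c k\<bar>) * (pi\<^sup>2 / n))"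
    by (intro sum_mono mult_left_mono L1_norm_grunwald_S_le) auto
  also have "\<dots> = pi * (\<Sum>k=1..n. \<bar>c k\<bar>)"
    using n by (simp add: sum_distrib_left power2_eq_square mult.commute)
  also have "\<dots> \<le> pi * (\<Sum>k=1..n. (LINT t|?M. \<bar>f t * grunwald_S n k t\<bar>))"
    unfolding c_def by (intro mult_left_mono sum_mono integral_abs_bound) auto
  \<comment> \<open>Moving the sum inside lets the pointwise bound act on all \<open>k\<close> at
    once; bounding each term separately would cost a factor \<open>n\<close>.\<close>
  also have "(\<Sum>k=1..n. (LINT t|?M. \<bar>f t * grunwald_S n k t\<bar>)) = (LINT t|?M. (\<Sum>k=1..n. \<bar>f t * grunwald_S n k t\<bar>))"
    by (subst Bochner_Integration.integral_sum)
       (auto intro!: integrable_abs integrable_times_grunwald_S f)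
  also have "\<dots> \<le> (LINT t|?M. pi * \<bar>f t\<bar>)"
  proof (intro integral_mono_AE)
    show "AE t in ?M. (\<Sum>k=1..n. \<bar>f t * grunwald_S n k t\<bar>) \<le> pi * \<bar>f t\<bar>"
      using AE_sum_abs_grunwald_S_le[OF n]
      by (rule eventually_mono) (auto simp: abs_mult mult.commute[of pi] intro!: mult_left_mono simp flip: sum_distrib_left)
  qed (auto intro!: Bochner_Integration.integrable_sum integrable_mult_right integrable_abs integrable_times_grunwald_S f)
  also have "\<dots> = pi * L1_norm f"
    by (simp add: L1_norm_def)
  finally show "L1_norm (grunwald_durrmeyer n f) \<le> pi\<^sup>2 * L1_norm f"
    by (simp add: power2_eq_square mult.assoc)
qed simp

end
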